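(* Let $m\ge 2$, $n\ge 1$, and let $\mathbb{A}$ and $\mathbb{B}$ be two similar complex tensors of order $m$ and dimension $n$. Then: (1) $\det(\mathbb{B})=\det(\mathbb{A})$. (2) $\phi_{\mathbb{B}}(\lambda)=\phi_{\mathbb{A}}(\lambda)$.
   Context: An order $m$ dimension $n$ tensor is an array $\mathbb{A}=(a_{i_1\cdots i_m})$ of complex numbers indexed by $[n]^m$, $[n]=\{1,\dots,n\}$. The unit tensor $\mathbb{I}$ of order $m$ and dimension $n$ has entry $1$ if $i_1=\cdots=i_m$ and $0$ otherwise. For a vector $x\in\mathbb{C}^n$, $\mathbb{A}x\in\mathbb{C}^n$ is the vector with $(\mathbb{A}x)_i=\sum_{i_2,\dots,i_m=1}^n a_{ii_2\cdots i_m}x_{i_2}\cdots x_{i_m}$. For $n\times n$ matrices $P=(p_{ij})$, $Q=(q_{ij})$, the tensor $P\mathbb{A}Q$ of order $m$ and dimension $n$ is $$(P\mathbb{A}Q)_{i_1\cdots i_m}=\sum_{j_1,\dots,j_m=1}^n a_{j_1\cdots j_m}p_{i_1j_1}q_{j_2i_2}\cdots q_{j_mi_m}.$$ Similarity: $\mathbb{A}$ and $\mathbb{B}$ (both of order $m$, dimension $n$) are similar if there exist complex $n\times n$ matrices $P,Q$ with $P\mathbb{I}Q=\mathbb{I}$ and $\mathbb{B}=P\mathbb{A}Q$. Hyperdeterminant: $\det(\mathbb{A})$ is the resultant of the system of $n$ homogeneous equations $\mathbb{A}x=0$ (of degree $m-1$ in $n$ variables); it is the unique polynomial in the entries of $\mathbb{A}$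 (viewed as independent variables) such that (i) $\det(\mathbb{A})=0$ iff $\mathbb{A}x=0$ has a nonzero solution $x\in\mathbb{C}^n$; (ii) $\det(\mathbb{I})=1$; (iii) $\det(\mathbb{A})$ is an irreducible polynomial in the entries of $\mathbb{A}$. Characteristic polynomial: $\phi_{\mathbb{A}}(\lambda)=\det(\lambda\mathbb{I}-\mathbb{A})$. *)

theory Defs
  imports Complex_Main "HOL-Library.Poly_Mapping" "Jordan_Normal_Form.Matrix"
begin

text \<open>
  A tensor of order \<open>m\<close> and dimension \<open>n\<close> is given by its entries at the index lists in
  \<open>tensor_indices m n\<close>; indices run over \<open>0, \<dots>, n - 1\<close>, as in \<^theory>\<open>Jordan_Normal_Form.Matrix\<close>.
  Values at other lists are irrelevant: every notion below that takes \<open>m\<close> and \<open>n\<close> as parameters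
  only inspects the entries at \<open>tensor_indices m n\<close>.
\<close>

type_synonym tensor = "nat list \<Rightarrow> complex"

definition tensor_indices :: "nat \<Rightarrow> nat \<Rightarrow> nat list set" where
  "tensor_indices m n = {is. set is \<subseteq> {..<n} \<and> length is = m}"

definition unit_tensor :: tensor where
  "unit_tensor is = (if \<forall>i\<in>set is. \<forall>j\<in>set is. i = j then 1 else 0)"

definition tensor_apply :: "nat \<Rightarrow> nat \<Rightarrow> tensor \<Rightarrow> complex vec \<Rightarrow> complex vec" where
  "tensor_apply m n A x =
     vec n (\<lambda>i. \<Sum>js\<in>tensor_indices (m - 1) n. A (i # js) * (\<Prod>k<m - 1. x $ (js ! k)))"

definition tensor_mult :: "nat \<Rightarrow> nat \<Rightarrow> complex mat \<Rightarrow> tensor \<Rightarrow> complex mat \<Rightarrow> tensor" where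
  "tensor_mult m n P A Q is =
     (\<Sum>js\<in>tensor_indices m n.
        A js * P $$ (is ! 0, js ! 0) * (\<Prod>k\<in>{1..<m}. Q $$ (js ! k, is ! k)))"

definition similar_tensors :: "nat \<Rightarrow> nat \<Rightarrow> tensor \<Rightarrow> tensor \<Rightarrow> bool" where
  "similar_tensors m n A B \<longleftrightarrow>
     (\<exists>P\<in>carrier_mat n n. \<exists>Q\<in>carrier_mat n n.
        (\<forall>is\<in>tensor_indices m n. tensor_mult m n P unit_tensor Q is = unit_tensor is) \<and>
        (\<forall>is\<in>tensor_indices m n. B is = tensor_mult m n P A Q is))"

text \<open>
  Polynomials in the entries of a tensor: the variables are index lists, a monomial is a finitely
  supported exponent function, and a polynomial maps monomials to their coefficients.
\<close>

type_synonym tensor_poly = "(nat list \<Rightarrow>\<^sub>0 nat) \<Rightarrow>\<^sub>0 complex"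

definition tensor_poly_vars :: "tensor_poly \<Rightarrow> nat list set" where
  "tensor_poly_vars D = (\<Union>e\<in>Poly_Mapping.keys D. Poly_Mapping.keys e)"

definition tensor_poly_eval :: "tensor_poly \<Rightarrow> tensor \<Rightarrow> complex" where
  "tensor_poly_eval D A =
     (\<Sum>e\<in>Poly_Mapping.keys D.
        Poly_Mapping.lookup D e * (\<Prod>v\<in>Poly_Mapping.keys e. A v ^ Poly_Mapping.lookup e v))"

text \<open>
  The characterization of the hyperdeterminant. Irreducibility is taken in the polynomial ring in
  all index lists; since the ring is a domain and \<open>D\<close> only involves the variables in
  \<open>tensor_indices m n\<close>, this is the same as irreducibility in the ring in those variables.
\<close>

definition is_hyperdet :: "nat \<Rightarrow> nat \<Rightarrow> tensor_poly \<Rightarrow> bool" where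
  "is_hyperdet m n D \<longleftrightarrow>
     tensor_poly_vars D \<subseteq> tensor_indices m n \<and>
     (\<forall>A. tensor_poly_eval D A = 0 \<longleftrightarrow>
        (\<exists>x\<in>carrier_vec n. x \<noteq> 0\<^sub>v n \<and> tensor_apply m n A x = 0\<^sub>v n)) \<and>
     tensor_poly_eval D unit_tensor = 1 \<and>
     irreducible D"

text \<open>
  For \<open>m \<ge> 2\<close> and \<open>n \<ge> 1\<close> exactly one polynomial \<open>D\<close> satisfies \<open>is_hyperdet m n D\<close> (the resultant of
  the system \<open>A x = 0\<close>); the hyperdeterminant of \<open>A\<close> is the value of this polynomial at \<open>A\<close>.
\<close>

definition hyperdet :: "nat \<Rightarrow> nat \<Rightarrow> tensor \<Rightarrow> complex" where
  "hyperdet m n A = (THE c. \<exists>D. is_hyperdet m n D \<and> c = tensor_poly_eval D A)"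

text \<open>As a function of \<open>c\<close>; over the complex numbers this determines the polynomial.\<close>

definition tensor_char_poly :: "nat \<Rightarrow> nat \<Rightarrow> tensor \<Rightarrow> complex \<Rightarrow> complex" where
  "tensor_char_poly m n A c = hyperdet m n (\<lambda>is. c * unit_tensor is - A is)"

end

theory Submission
  imports
    Defs
    "Jordan_Normal_Form.Determinant"
    "HOL-Computational_Algebra.Fundamental_Theorem_Algebra"
    "HOL-Analysis.Continuum_Not_Denumerable"
begin

text \<open>
  Let \<open>D\<close> be a hyperdeterminant and \<open>P I Q = I\<close> for the unit tensor \<open>I\<close>. Put
  \<open>P\<^sub>s = 1 + s (P - 1)\<close> and \<open>Q\<^sub>s = 1 + s (Q - 1)\<close>. Since \<open>(P A Q) x = P (A (Q x))\<close>, for every \<open>A\<close>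
  with \<open>D A \<noteq> 0\<close> the zeros of the polynomial \<open>s \<mapsto> D (P\<^sub>s A Q\<^sub>s)\<close> are among the finitely many zeros
  of \<open>det P\<^sub>s det Q\<^sub>s\<close>. Hence the ratio \<open>D (P A Q) / D A\<close> of its values at \<open>1\<close> and \<open>0\<close> lies in a
  countable set that does not depend on \<open>A\<close>. Along the line from \<open>I\<close> to an arbitrary \<open>A\<close> this ratio is
  a rational function with countably many values, hence constant, and at \<open>I\<close> it equals \<open>1\<close>.
\<close>

subsection \<open>Univariate polynomial functions\<close>

text \<open>Phrased for functions, so that polynomial dependence on a parameter follows from closure
  rules and a witness \<open>p\<close> is extracted only at the end.\<close>

definition polyfun :: "('a::comm_ring_1 \<Rightarrow> 'a) \<Rightarrow> bool" where
  "polyfun f \<longleftrightarrow> (\<exists>p. f = poly p)"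

lemma polyfun_const: "polyfun (\<lambda>s. c)"
  unfolding polyfun_def by (rule exI[of _ "[:c:]"]) auto

lemma polyfun_ident: "polyfun (\<lambda>s. s)"
  unfolding polyfun_def by (rule exI[of _ "[:0, 1:]"]) auto

lemma polyfun_add: "polyfun f \<Longrightarrow> polyfun g \<Longrightarrow> polyfun (\<lambda>s. f s + g s)"
  unfolding polyfun_def by (elim exE, rule_tac x = "p + pa" in exI) (simp add: fun_eq_iff)

lemma polyfun_mult: "polyfun f \<Longrightarrow> polyfun g \<Longrightarrow> polyfun (\<lambda>s. f s * g s)"
  unfolding polyfun_def by (elim exE, rule_tac x = "p * pa" in exI) (simp add: fun_eq_iff)

lemma polyfun_power: "polyfun f \<Longrightarrow> polyfun (\<lambda>s. f s ^ k)"
  unfolding polyfun_def by (elim exE, rule_tac x = "p ^ k" in exI) (simp add: fun_eq_iff)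

lemma polyfun_sum: "(\<And>i. i \<in> I \<Longrightarrow> polyfun (f i)) \<Longrightarrow> polyfun (\<lambda>s. \<Sum>i\<in>I. f i s)"
  by (induction I rule: infinite_finite_induct) (auto intro: polyfun_const polyfun_add)

lemma polyfun_prod: "(\<And>i. i \<in> I \<Longrightarrow> polyfun (f i)) \<Longrightarrow> polyfun (\<lambda>s. \<Prod>i\<in>I. f i s)"
  by (induction I rule: infinite_finite_induct) (auto intro: polyfun_const polyfun_mult)

lemmas polyfun_intros =
  polyfun_const polyfun_ident polyfun_add polyfun_mult polyfun_power polyfun_sum polyfun_prod

text \<open>Over the complex numbers \<open>p\<close> splits into linear factors, and the leading
  coefficient cancels in the quotient of the values at 1 and 0. The list \<open>as\<close> holds the
  roots with multiplicity: its length depends on \<open>p\<close>, its alphabet \<open>S\<close>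
  does not.\<close>

lemma poly_ratio_in_root_products:
  fixes p :: "complex poly"
  assumes p0: "poly p 0 \<noteq> 0" and roots: "{x. poly p x = 0} \<subseteq> S"
  shows "\<exists>as\<in>lists S. poly p 1 = (\<Prod>a\<leftarrow>as. (1 - a) / (0 - a)) * poly p 0"
proof -
  obtain r where r: "smult (lead_coeff p) (\<Prod>i<degree p. [:- r i, 1:]) = p"
    using complex_poly_decompose' by metis
  have ev: "poly p x = lead_coeff p * (\<Prod>i<degree p. x - r i)" for x
    by (subst r[symmetric]) (simp add: poly_prod)
  have nz: "r i \<noteq> 0" if "i < degree p" for i
    using p0 that by (auto simp: ev)
  have mem: "r i \<in> S" if "i < degree p" for i
  proof -
    have "(\<Prod>j<degree p. r i - r j) = 0" using that by auto
    then show ?thesis using roots by (auto simp: ev)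
  qed
  let ?as = "map r [0..<degree p]"
  have "(\<Prod>a\<leftarrow>?as. (1 - a) / (0 - a)) = (\<Prod>i<degree p. (1 - r i) / (0 - r i))"
    by (simp add: prod.list_conv_set_nth atLeast0LessThan)
  also have "\<dots> = (\<Prod>i<degree p. 1 - r i) / (\<Prod>i<degree p. 0 - r i)"
    by (rule prod_dividef)
  finally have "poly p 1 = (\<Prod>a\<leftarrow>?as. (1 - a) / (0 - a)) * poly p 0"
    using nz by (simp add: ev)
  moreover have "?as \<in> lists S" using mem by auto
  ultimately show ?thesis by blast
qed

text \<open>Otherwise each \<open>p - smult v q\<close> has finitely many roots, and these roots for
  \<open>v\<close> in \<open>V\<close>, together with those of \<open>q\<close>, would cover the
  uncountable complex plane by a countable set.\<close>

lemma polys_proportional_if_countable_ratios: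
  fixes p q :: "complex poly"
  assumes V: "countable V" and q0: "q \<noteq> 0"
    and ratio: "\<And>s. poly q s \<noteq> 0 \<Longrightarrow> \<exists>v\<in>V. poly p s = v * poly q s"
  shows "\<exists>v. p = smult v q"
proof (rule ccontr)
  assume "\<nexists>v. p = smult v q"
  then have fin: "finite {s. poly (p - smult v q) s = 0}" for v
    by (intro poly_roots_finite) auto
  have "UNIV \<subseteq> {s. poly q s = 0} \<union> (\<Union>v\<in>V. {s. poly (p - smult v q) s = 0})"
    using ratio by auto
  moreover have "countable ({s. poly q s = 0} \<union> (\<Union>v\<in>V. {s. poly (p - smult v q) s = 0}))"
    using V fin poly_roots_finite[OF q0] by (auto intro: countable_finite)
  ultimately show False
    using uncountable_UNIV_complex countable_subset by blast
qed

subsection \<open>Tensor algebra\<close>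

lemma finite_tensor_indices: "finite (tensor_indices m n)"
  unfolding tensor_indices_def by (rule finite_lists_length_eq) simp

lemma tensor_indices_0: "tensor_indices 0 n = {[]}"
  by (auto simp: tensor_indices_def)

lemma tensor_indices_Suc:
  "tensor_indices (Suc r) n = (\<lambda>(i, js). i # js) ` ({..<n} \<times> tensor_indices r n)"
  by (auto simp: tensor_indices_def length_Suc_conv)

lemma sum_tensor_indices_Suc:
  "(\<Sum>js\<in>tensor_indices (Suc r) n. f js) =
     (\<Sum>j<n. \<Sum>js\<in>tensor_indices r n. f (j # js))"
  unfolding tensor_indices_Suc sum.cartesian_product
  by (subst sum.reindex) (auto simp: inj_on_def case_prod_beta)

lemma nth_tensor_indices: "is \<in> tensor_indices m n \<Longrightarrow> k < m \<Longrightarrow> is ! k < n"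
  by (auto simp: tensor_indices_def) (meson lessThan_iff nth_mem subsetD)

text \<open>Distributivity: choosing a summand in each of the \<open>r\<close> factors amounts to
  choosing an index list. This expands products of coordinates of \<open>Q x\<close>.\<close>

lemma prod_sum_tensor_indices:
  fixes g :: "nat \<Rightarrow> nat \<Rightarrow> 'a::comm_semiring_1"
  shows "(\<Prod>k<r. \<Sum>l<n. g k l) = (\<Sum>is\<in>tensor_indices r n. \<Prod>k<r. g k (is ! k))"
proof (induction r arbitrary: g)
  case 0
  then show ?case by (simp add: tensor_indices_0)
next
  case (Suc r)
  have "(\<Prod>k<Suc r. \<Sum>l<n. g k l) = (\<Sum>l<n. g 0 l) * (\<Prod>k<r. \<Sum>l<n. g (Suc k) l)"
    by (rule prod.lessThan_Suc_shift)
  also have "\<dots> = (\<Sum>l<n. g 0 l) * (\<Sum>is\<in>tensor_indices r n. \<Prod>k<r. g (Suc k) (is ! k))"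
    by (simp add: Suc)
  also have "\<dots> = (\<Sum>is\<in>tensor_indices (Suc r) n. \<Prod>k<Suc r. g k (is ! k))"
    by (simp add: sum_tensor_indices_Suc prod.lessThan_Suc_shift sum_product del: prod.lessThan_Suc)
  finally show ?case .
qed

lemma tensor_apply_carrier [simp]: "tensor_apply m n A x \<in> carrier_vec n"
  by (simp add: tensor_apply_def)

text \<open>Splits off the first index, on which \<open>P\<close> acts, and shifts the remaining
  product to start at 0, the shape used by \<open>tensor_apply\<close>.\<close>

lemma tensor_mult_Cons:
  assumes "m \<ge> 1"
  shows "tensor_mult m n P A Q (i # is) =
    (\<Sum>j<n. \<Sum>js\<in>tensor_indices (m - 1) n.
       A (j # js) * P $$ (i, j) * (\<Prod>k<m - 1. Q $$ (js ! k, is ! k)))"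
proof -
  obtain r where m: "m = Suc r" using assms by (cases m) auto
  have "(\<Prod>k = 1..<Suc r. f k) = (\<Prod>k<r. f (Suc k))" for f :: "nat \<Rightarrow> complex"
    by (simp add: prod.atLeast_Suc_lessThan_Suc_shift atLeast0LessThan del: prod.op_ivl_Suc)
  then show ?thesis
    by (simp add: tensor_mult_def m sum_tensor_indices_Suc del: prod.op_ivl_Suc)
qed

text \<open>The factors of \<open>Q\<close> at the trailing indices can be moved onto the copies of
  \<open>x\<close>. This relates the zeros of the two tensors.\<close>

lemma tensor_apply_mult:
  assumes m: "m \<ge> 1" and P: "P \<in> carrier_mat n n" and Q: "Q \<in> carrier_mat n n"
    and x: "x \<in> carrier_vec n"
  shows "tensor_apply m n (tensor_mult m n P A Q) x = P *\<^sub>v tensor_apply m n A (Q *\<^sub>v x)"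
proof (rule eq_vecI)
  let ?T = "tensor_indices (m - 1) n"
  fix i assume "i < dim_vec (P *\<^sub>v tensor_apply m n A (Q *\<^sub>v x))"
  then have i: "i < n" using P by simp
  have Qx: "(Q *\<^sub>v x) $ l = (\<Sum>j<n. Q $$ (l, j) * x $ j)" if "l < n" for l
    using that Q x by (auto simp: scalar_prod_def atLeast0LessThan)
  have expand: "(\<Prod>k<m - 1. (Q *\<^sub>v x) $ (js ! k)) =
      (\<Sum>is\<in>?T. (\<Prod>k<m - 1. Q $$ (js ! k, is ! k)) * (\<Prod>k<m - 1. x $ (is ! k)))"
    if "js \<in> ?T" for js
  proof -
    have "(\<Prod>k<m - 1. (Q *\<^sub>v x) $ (js ! k)) = (\<Prod>k<m - 1. \<Sum>j<n. Q $$ (js ! k, j) * x $ j)"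
      using nth_tensor_indices[OF that] by (intro prod.cong) (auto simp: Qx)
    then show ?thesis by (simp add: prod_sum_tensor_indices prod.distrib)
  qed
  have "tensor_apply m n (tensor_mult m n P A Q) x $ i =
      (\<Sum>is\<in>?T. \<Sum>j<n. \<Sum>js\<in>?T. A (j # js) * P $$ (i, j) *
         (\<Prod>k<m - 1. Q $$ (js ! k, is ! k)) * (\<Prod>k<m - 1. x $ (is ! k)))"
    using i by (simp add: tensor_apply_def tensor_mult_Cons[OF m] sum_distrib_right)
  \<comment> \<open>Two exchanges make the sum over \<open>is\<close> innermost, where
    \<open>expand\<close> collapses it to coordinates of \<open>Q x\<close>.\<close>
  also have "\<dots> = (\<Sum>j<n. \<Sum>is\<in>?T. \<Sum>js\<in>?T. A (j # js) * P $$ (i, j) *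
         (\<Prod>k<m - 1. Q $$ (js ! k, is ! k)) * (\<Prod>k<m - 1. x $ (is ! k)))"
    by (rule sum.swap)
  also have "\<dots> = (\<Sum>j<n. \<Sum>js\<in>?T. \<Sum>is\<in>?T. A (j # js) * P $$ (i, j) *
         (\<Prod>k<m - 1. Q $$ (js ! k, is ! k)) * (\<Prod>k<m - 1. x $ (is ! k)))"
    by (rule sum.cong[OF refl], rule sum.swap)
  also have "\<dots> = (\<Sum>j<n. P $$ (i, j) *
      (\<Sum>js\<in>?T. A (j # js) * (\<Prod>k<m - 1. (Q *\<^sub>v x) $ (js ! k))))"
    by (simp add: expand sum_distrib_left mult_ac del: One_nat_def)
  also have "\<dots> = (P *\<^sub>v tensor_apply m n A (Q *\<^sub>v x)) $ i"
    using i P by (simp add: tensor_apply_def scalar_prod_def atLeast0LessThan)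
  finally show "tensor_apply m n (tensor_mult m n P A Q) x $ i =
      (P *\<^sub>v tensor_apply m n A (Q *\<^sub>v x)) $ i" .
qed (use P in \<open>auto simp: tensor_apply_def\<close>)

text \<open>Linearity in the middle factor. Combined with \<open>P I Q = I\<close> it reduces
  characteristic polynomials to hyperdeterminants.\<close>

lemma tensor_mult_diff_unit:
  "tensor_mult m n P (\<lambda>is. c * unit_tensor is - A is) Q is =
     c * tensor_mult m n P unit_tensor Q is - tensor_mult m n P A Q is"
  by (simp add: tensor_mult_def algebra_simps sum_distrib_left sum_subtractf)

subsection \<open>Hyperdeterminants under matrix multiplication\<close>

text \<open>Similarity prescribes entries only on \<open>tensor_indices m n\<close>, so equalities
  between tensors are available only there.\<close>

lemma tensor_poly_eval_cong:
  assumes "tensor_poly_vars D \<subseteq> S" "\<And>is. is \<in> S \<Longrightarrow> A is = B is"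
  shows "tensor_poly_eval D A = tensor_poly_eval D B"
proof -
  have "A v = B v" if "e \<in> Poly_Mapping.keys D" "v \<in> Poly_Mapping.keys e" for e v
    using assms that unfolding tensor_poly_vars_def by blast
  then show ?thesis unfolding tensor_poly_eval_def by (auto intro!: sum.cong prod.cong)
qed

lemma polyfun_tensor_poly_eval:
  "(\<And>is. polyfun (\<lambda>s. A s is)) \<Longrightarrow> polyfun (\<lambda>s. tensor_poly_eval D (A s))"
  unfolding tensor_poly_eval_def by (intro polyfun_intros)

lemma polyfun_tensor_mult:
  assumes "\<And>i j. i < n \<Longrightarrow> j < n \<Longrightarrow> polyfun (\<lambda>s. P s $$ (i, j))"
    and "\<And>i j. i < n \<Longrightarrow> j < n \<Longrightarrow> polyfun (\<lambda>s. Q s $$ (i, j))"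
    and "\<And>is. polyfun (\<lambda>s. A s is)" and "m \<ge> 1" and "is \<in> tensor_indices m n"
  shows "polyfun (\<lambda>s. tensor_mult m n (P s) (A s) (Q s) is)"
  unfolding tensor_mult_def using assms
  by (intro polyfun_intros assms) (auto intro: nth_tensor_indices)

lemma polyfun_det:
  assumes "\<And>s. P s \<in> carrier_mat n n"
    and "\<And>i j. i < n \<Longrightarrow> j < n \<Longrightarrow> polyfun (\<lambda>s. P s $$ (i, j))"
  shows "polyfun (\<lambda>s. det (P s))"
  unfolding det_def'[OF assms(1)]
  by (intro polyfun_intros assms(2)) (auto simp: permutes_in_image)

text \<open>The segment starts at the identity for every \<open>P\<close>, so the determinant along
  it is a nonzero polynomial in \<open>s\<close> even if \<open>P\<close> is singular.\<close>

definition id_segment :: "nat \<Rightarrow> complex mat \<Rightarrow> complex \<Rightarrow> complex mat" where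
  "id_segment n P s = mat n n (\<lambda>ij. 1\<^sub>m n $$ ij + s * (P $$ ij - 1\<^sub>m n $$ ij))"

lemma id_segment_carrier [simp]: "id_segment n P s \<in> carrier_mat n n"
  by (simp add: id_segment_def)

lemma id_segment_0: "id_segment n P 0 = 1\<^sub>m n"
  by (rule eq_matI) (auto simp: id_segment_def)

lemma id_segment_1: "P \<in> carrier_mat n n \<Longrightarrow> id_segment n P 1 = P"
  by (rule eq_matI) (auto simp: id_segment_def)

lemma polyfun_id_segment:
  "i < n \<Longrightarrow> j < n \<Longrightarrow> polyfun (\<lambda>s. id_segment n P s $$ (i, j))"
  by (auto simp: id_segment_def intro!: polyfun_intros)

lemma finite_det_id_segment_roots: "finite {s. det (id_segment n P s) = 0}"
proof -
  obtain p where p: "(\<lambda>s. det (id_segment n P s)) = poly p"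
    using polyfun_det[of "id_segment n P" n] polyfun_id_segment unfolding polyfun_def by auto
  have "poly p 0 = 1" by (simp add: p[symmetric] id_segment_0)
  then have "p \<noteq> 0" by auto
  then have "finite {s. poly p s = 0}" by (rule poly_roots_finite)
  then show ?thesis by (simp add: p[symmetric])
qed

lemma tensor_mult_one:
  assumes "m \<ge> 1" "is \<in> tensor_indices m n"
  shows "tensor_mult m n (1\<^sub>m n) A (1\<^sub>m n) is = A is"
proof -
  have len: "length is = m" using assms by (simp add: tensor_indices_def)
  have "A js * 1\<^sub>m n $$ (is ! 0, js ! 0) * (\<Prod>k\<in>{1..<m}. 1\<^sub>m n $$ (js ! k, is ! k)) =
      (if js = is then A is else 0)" if js: "js \<in> tensor_indices m n" for js
  proof (cases "js = is")
    case True
    then show ?thesis using assms nth_tensor_indices[OF assms(2)] by auto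
  next
    case False
    have "length js = m" using js by (simp add: tensor_indices_def)
    then obtain k where k: "k < m" "js ! k \<noteq> is ! k"
      using False len by (auto simp: list_eq_iff_nth_eq)
    \<comment> \<open>A mismatch at position 0 annihilates the factor of the left matrix, any other
      one a factor of the right matrix.\<close>
    show ?thesis
    proof (cases "k = 0")
      case True
      then show ?thesis
        using False k nth_tensor_indices[OF assms(2)] nth_tensor_indices[OF js] by auto
    next
      case False
      then have "(\<Prod>k\<in>{1..<m}. 1\<^sub>m n $$ (js ! k, is ! k)) = (0 :: complex)"
        using k nth_tensor_indices[OF assms(2)] nth_tensor_indices[OF js]
        by (intro prod_zero) (auto intro!: bexI[of _ k])
      then show ?thesis using \<open>js \<noteq> is\<close> by simp
    qed
  qed
  then show ?thesis
    using assms by (simp add: tensor_mult_def finite_tensor_indices cong: sum.cong)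
qed

text \<open>A nontrivial zero \<open>x\<close> of the product would yield the zero
  \<open>Q x\<close> of \<open>A\<close>: invertibility of \<open>P\<close> strips the outer factor,
  that of \<open>Q\<close> keeps \<open>Q x\<close> nonzero.\<close>

lemma hyperdet_mult_nonzero:
  assumes D: "is_hyperdet m n D" and m: "m \<ge> 1"
    and P: "P \<in> carrier_mat n n" "det P \<noteq> 0" and Q: "Q \<in> carrier_mat n n" "det Q \<noteq> 0"
    and A: "tensor_poly_eval D A \<noteq> 0"
  shows "tensor_poly_eval D (tensor_mult m n P A Q) \<noteq> 0"
proof
  have zero_iff: "tensor_poly_eval D A = 0 \<longleftrightarrow>
      (\<exists>x\<in>carrier_vec n. x \<noteq> 0\<^sub>v n \<and> tensor_apply m n A x = 0\<^sub>v n)" for A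
    using D unfolding is_hyperdet_def by blast
  assume "tensor_poly_eval D (tensor_mult m n P A Q) = 0"
  then obtain x where x: "x \<in> carrier_vec n" "x \<noteq> 0\<^sub>v n"
      "tensor_apply m n (tensor_mult m n P A Q) x = 0\<^sub>v n"
    using zero_iff by blast
  have "P *\<^sub>v tensor_apply m n A (Q *\<^sub>v x) = 0\<^sub>v n"
    using x tensor_apply_mult[OF m P(1) Q(1) x(1)] by simp
  then have "tensor_apply m n A (Q *\<^sub>v x) = 0\<^sub>v n"
    using P det_0_iff_vec_prod_zero[OF P(1)] tensor_apply_carrier by blast
  moreover have "Q *\<^sub>v x \<noteq> 0\<^sub>v n"
    using x Q det_0_iff_vec_prod_zero[OF Q(1)] by blast
  moreover have "Q *\<^sub>v x \<in> carrier_vec n" using Q x by simp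
  ultimately have "tensor_poly_eval D A = 0" using zero_iff by blast
  with A show False by simp
qed

text \<open>The point is the order of quantifiers: \<open>V\<close> depends on \<open>P\<close> and
  \<open>Q\<close> but serves all \<open>A\<close>. For singular \<open>P\<close> or
  \<open>Q\<close>, 1 lies in \<open>S\<close> and \<open>V\<close> contains 0.\<close>

lemma hyperdet_mult_countable_ratios:
  assumes D: "is_hyperdet m n D" and m: "m \<ge> 1"
    and P: "P \<in> carrier_mat n n" and Q: "Q \<in> carrier_mat n n"
  obtains V where "countable V"
    "\<And>A. tensor_poly_eval D A \<noteq> 0 \<Longrightarrow>
      \<exists>v\<in>V. tensor_poly_eval D (tensor_mult m n P A Q) = v * tensor_poly_eval D A"
proof
  have vars: "tensor_poly_vars D \<subseteq> tensor_indices m n"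
    using D unfolding is_hyperdet_def by blast
  define S where "S = {s. det (id_segment n P s) = 0} \<union> {s. det (id_segment n Q s) = 0}"
  \<comment> \<open>The multiplicities of the roots may vary with \<open>A\<close>, hence all finite
    lists over \<open>S\<close>.\<close>
  let ?V = "(\<lambda>as. \<Prod>a\<leftarrow>as. (1 - a) / (0 - a)) ` lists S"
  have "finite S" by (simp add: S_def finite_det_id_segment_roots)
  then show "countable ?V"
    by (intro countable_image countable_lists countable_finite)
  fix A assume A: "tensor_poly_eval D A \<noteq> 0"
  \<comment> \<open>cut off outside \<open>tensor_indices m n\<close>, where \<open>tensor_mult\<close> reads undefined matrix entries\<close>
  define M where "M s is = (if is \<in> tensor_indices m n
      then tensor_mult m n (id_segment n P s) A (id_segment n Q s) is else 0)" for s "is"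
  have M: "tensor_poly_eval D (M s) =
      tensor_poly_eval D (tensor_mult m n (id_segment n P s) A (id_segment n Q s))" for s
    by (rule tensor_poly_eval_cong[OF vars]) (simp add: M_def)
  have "polyfun (\<lambda>s. M s is)" for "is"
  proof (cases "is \<in> tensor_indices m n")
    case True
    then show ?thesis
      using m by (simp add: M_def polyfun_tensor_mult polyfun_id_segment polyfun_const)
  qed (simp add: M_def polyfun_const)
  then obtain p where p: "(\<lambda>s. tensor_poly_eval D (M s)) = poly p"
    using polyfun_tensor_poly_eval unfolding polyfun_def by metis
  have p_at: "poly p s =
      tensor_poly_eval D (tensor_mult m n (id_segment n P s) A (id_segment n Q s))" for s
    by (simp add: p[symmetric] M)
  have p0: "poly p 0 = tensor_poly_eval D A"
    unfolding p_at id_segment_0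
    by (rule tensor_poly_eval_cong[OF vars]) (simp add: tensor_mult_one[OF m])
  have p1: "poly p 1 = tensor_poly_eval D (tensor_mult m n P A Q)"
    using P Q by (simp add: p_at id_segment_1)
  have "{s. poly p s = 0} \<subseteq> S"
    using hyperdet_mult_nonzero[OF D m id_segment_carrier _ id_segment_carrier _ A]
    by (auto simp: p_at S_def)
  from poly_ratio_in_root_products[OF _ this]
  show "\<exists>v\<in>?V. tensor_poly_eval D (tensor_mult m n P A Q) = v * tensor_poly_eval D A"
    using A by (simp add: p0 p1)
qed

text \<open>Proportionality is an identity of polynomials along the line from the unit tensor to
  \<open>A\<close>, so the case where \<open>D\<close> vanishes at \<open>A\<close> is covered
  too.\<close>

lemma hyperdet_eval_mult:
  assumes D: "is_hyperdet m n D" and m: "m \<ge> 1"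
    and P: "P \<in> carrier_mat n n" and Q: "Q \<in> carrier_mat n n"
    and PIQ: "\<And>is. is \<in> tensor_indices m n \<Longrightarrow> tensor_mult m n P unit_tensor Q is = unit_tensor is"
  shows "tensor_poly_eval D (tensor_mult m n P A Q) = tensor_poly_eval D A"
proof -
  have vars: "tensor_poly_vars D \<subseteq> tensor_indices m n"
    and unit: "tensor_poly_eval D unit_tensor = 1"
    using D unfolding is_hyperdet_def by blast+
  define L where "L s is = unit_tensor is + s * (A is - unit_tensor is)" for s "is"
  have L0: "L 0 = unit_tensor" and L1: "L 1 = A" by (auto simp: L_def)
  have L: "polyfun (\<lambda>s. L s is)" for "is"
    unfolding L_def by (intro polyfun_intros)
  \<comment> \<open>Cut off because \<open>polyfun_tensor_mult\<close> speaks only about lists in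
    \<open>tensor_indices m n\<close>.\<close>
  define M where "M s is = (if is \<in> tensor_indices m n
      then tensor_mult m n P (L s) Q is else 0)" for s "is"
  have M: "tensor_poly_eval D (M s) = tensor_poly_eval D (tensor_mult m n P (L s) Q)" for s
    by (rule tensor_poly_eval_cong[OF vars]) (simp add: M_def)
  have "polyfun (\<lambda>s. M s is)" for "is"
  proof (cases "is \<in> tensor_indices m n")
    case True
    then show ?thesis
      using m L by (simp add: M_def polyfun_tensor_mult polyfun_const)
  qed (simp add: M_def polyfun_const)
  then obtain p where p: "(\<lambda>s. tensor_poly_eval D (M s)) = poly p"
    using polyfun_tensor_poly_eval unfolding polyfun_def by metis
  have p_at: "poly p s = tensor_poly_eval D (tensor_mult m n P (L s) Q)" for s
    by (simp add: p[symmetric] M)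
  obtain q where q: "(\<lambda>s. tensor_poly_eval D (L s)) = poly q"
    using polyfun_tensor_poly_eval L unfolding polyfun_def by metis
  have q_at: "poly q s = tensor_poly_eval D (L s)" for s
    by (simp add: q[symmetric])
  have q0: "poly q 0 = 1" by (simp add: q_at L0 unit)
  have "tensor_poly_eval D (tensor_mult m n P unit_tensor Q) = tensor_poly_eval D unit_tensor"
    by (rule tensor_poly_eval_cong[OF vars]) (rule PIQ)
  then have p0: "poly p 0 = 1" by (simp add: p_at L0 unit)
  obtain V where "countable V" "\<And>A. tensor_poly_eval D A \<noteq> 0 \<Longrightarrow>
      \<exists>v\<in>V. tensor_poly_eval D (tensor_mult m n P A Q) = v * tensor_poly_eval D A"
    using hyperdet_mult_countable_ratios[OF D m P Q] by metis
  moreover have "q \<noteq> 0" using q0 by auto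
  ultimately obtain v where v: "p = smult v q"
    using polys_proportional_if_countable_ratios[of V q p] by (auto simp: p_at q_at)
  \<comment> \<open>Comparison at \<open>s = 0\<close>, the unit tensor, where \<open>PIQ\<close>
    makes both polynomials 1.\<close>
  have "v = 1" using p0 q0 v by simp
  with v have "poly p 1 = poly q 1" by simp
  then show ?thesis by (simp add: p_at q_at L1)
qed

text \<open>Each \<open>D\<close> with \<open>is_hyperdet m n D\<close> takes the same value at
  \<open>A\<close> and \<open>B\<close>, so the predicates under \<open>THE\<close>
  coincide.\<close>

lemma hyperdet_eq_if_mult:
  assumes m: "m \<ge> 1" and P: "P \<in> carrier_mat n n" and Q: "Q \<in> carrier_mat n n"
    and PIQ: "\<And>is. is \<in> tensor_indices m n \<Longrightarrow> tensor_mult m n P unit_tensor Q is = unit_tensor is"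
    and B: "\<And>is. is \<in> tensor_indices m n \<Longrightarrow> B is = tensor_mult m n P A Q is"
  shows "hyperdet m n B = hyperdet m n A"
proof -
  have "tensor_poly_eval D B = tensor_poly_eval D A" if D: "is_hyperdet m n D" for D
  proof -
    have "tensor_poly_vars D \<subseteq> tensor_indices m n"
      using D unfolding is_hyperdet_def by blast
    then have "tensor_poly_eval D B = tensor_poly_eval D (tensor_mult m n P A Q)"
      by (rule tensor_poly_eval_cong) (rule B)
    then show ?thesis using hyperdet_eval_mult[OF D m P Q PIQ] by simp
  qed
  then have "(\<lambda>c. \<exists>D. is_hyperdet m n D \<and> c = tensor_poly_eval D B) =
      (\<lambda>c. \<exists>D. is_hyperdet m n D \<and> c = tensor_poly_eval D A)"
    by (metis (no_types, lifting))
  then show ?thesis unfolding hyperdet_def by simp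
qed

theorem theorem2p1:
  fixes m n :: nat and A B :: tensor
  assumes "m \<ge> 2" and "n \<ge> 1" and "similar_tensors m n A B"
  shows "hyperdet m n B = hyperdet m n A \<and>
    (\<forall>c. tensor_char_poly m n B c = tensor_char_poly m n A c)"
proof -
  obtain P Q where PQ: "P \<in> carrier_mat n n" "Q \<in> carrier_mat n n"
    and PIQ: "\<And>is. is \<in> tensor_indices m n \<Longrightarrow> tensor_mult m n P unit_tensor Q is = unit_tensor is"
    and B: "\<And>is. is \<in> tensor_indices m n \<Longrightarrow> B is = tensor_mult m n P A Q is"
    using assms(3) unfolding similar_tensors_def by blast
  have m: "m \<ge> 1" using assms(1) by simp
  \<comment> \<open>The same \<open>P\<close> and \<open>Q\<close> carry \<open>c I - A\<close> to
    \<open>c I - B\<close>.\<close>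
  have "tensor_char_poly m n B c = tensor_char_poly m n A c" for c
    unfolding tensor_char_poly_def
    by (rule hyperdet_eq_if_mult[OF m PQ PIQ]) (simp_all add: B PIQ tensor_mult_diff_unit)
  then show ?thesis
    using hyperdet_eq_if_mult[OF m PQ PIQ B] by simp
qed

end
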